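(* Let $N \ge 1$ and let $P(z) = \prod_{j=1}^{N} (z-\alpha_j) = z^N + a_{N-1} z^{N-1} + \cdots + a_0$ be a monic polynomial of degree $N$ with complex coefficients and with $a_0 \neq 0$, and write its roots (listed with multiplicity) as $\alpha_j = \rho_j e^{i\theta_j}$ with $\rho_j > 0$ and $\theta_j$ real. Then $$\mathcal{D}(P) \le \frac{8}{\pi} \sqrt{N\, h(P)},$$ where $\mathcal{D}(P)$ is the discrepancy of the angles of the roots and $h(P)$ is the logarithmic size of $P$ on the unit circle, both defined in the context.
   Context: Put $\log^+ x = \max(0,\log x)$ for $x>0$, with $\log^+ 0 = 0$, and $$h(P) = \frac{1}{2\pi} \int_0^{2\pi} \log^+ \frac{|P(e^{i\theta})|}{\sqrt{|a_0|}}\, d\theta .$$ For an arc $I$ on the unit circle (with or without its endpoints), let $|I|$ denote its length, and let $N(I;P)$ denote the number of indices $j \in \{1,\dots,N\}$ (i.e. roots counted with multiplicity) with $e^{i\theta_j} \in I$. The discrepancy is $$\mathcal{D}(P) = \max_{I} \Big| N(I;P) - \frac{|I|}{2\pi} N \Big|,$$ where the maximum is over all arcs $I$ on the unit circle. *)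

theory Defs
  imports "HOL-Analysis.Analysis" "HOL-Computational_Algebra.Polynomial"
begin

definition log_plus :: "real \<Rightarrow> real" where
  "log_plus x = (if x > 0 then max 0 (ln x) else 0)"

definition log_size :: "complex poly \<Rightarrow> real" where
  "log_size P = 1 / (2 * pi) *
     integral {0..2 * pi} (\<lambda>t. log_plus (cmod (poly P (cis t)) / sqrt (cmod (coeff P 0))))"

text \<open>
  \<open>circle_arc I L\<close>: the set \<open>I\<close> is an arc of the unit circle of length \<open>L\<close>. The interval \<open>T\<close> of
  angles may contain both, one or none of its endpoints. Arcs that reduce to a point or to the
  empty set (\<open>L = 0\<close>) and the full circle (\<open>L = 2 * pi\<close>) are included.
\<close>

definition circle_arc :: "complex set \<Rightarrow> real \<Rightarrow> bool" where
  "circle_arc I L \<longleftrightarrow> (\<exists>a b T. a \<le> b \<and> b \<le> a + 2 * pi \<and> {a<..<b} \<subseteq> T \<and> T \<subseteq> {a..b} \<and>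
                          I = cis ` T \<and> L = b - a)"

definition arc_count :: "nat \<Rightarrow> (nat \<Rightarrow> real) \<Rightarrow> complex set \<Rightarrow> nat" where
  "arc_count N \<theta> I = card {j \<in> {1..N}. cis (\<theta> j) \<in> I}"

definition arc_deviations :: "nat \<Rightarrow> (nat \<Rightarrow> real) \<Rightarrow> real set" where
  "arc_deviations N \<theta> =
     {\<bar>real (arc_count N \<theta> I) - L / (2 * pi) * real N\<bar> | I L. circle_arc I L}"

text \<open>The supremum is a maximum: see \<open>discrepancy_attained\<close> and \<open>deviation_le_discrepancy\<close> below.\<close>

definition discrepancy :: "nat \<Rightarrow> (nat \<Rightarrow> real) \<Rightarrow> real" where
  "discrepancy N \<theta> = Sup (arc_deviations N \<theta>)"

lemma deviation_le_closed_arc: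
  assumes "circle_arc I L"
  obtains w l where "cmod w = 1" "0 \<le> l" "l \<le> 2 * pi"
    "\<bar>real (arc_count N \<theta> I) - L / (2 * pi) * real N\<bar>
       \<le> real (arc_count N \<theta> ((\<lambda>t. w * cis t) ` {0..l})) - l / (2 * pi) * real N"
proof -
  obtain a b T where ab: "a \<le> b" "b \<le> a + 2 * pi" "{a<..<b} \<subseteq> T" "T \<subseteq> {a..b}"
    and I: "I = cis ` T" and L: "L = b - a"
    using assms unfolding circle_arc_def by blast
  define w1 l1 w2 l2 where "w1 = cis a" and "l1 = b - a" and "w2 = cis b" and "l2 = a + 2 * pi - b"
  have "I \<subseteq> (\<lambda>t. w1 * cis t) ` {0..l1}"
  proof
    fix z assume "z \<in> I"
    then obtain s where "s \<in> T" "z = cis s" using I by blast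
    then show "z \<in> (\<lambda>t. w1 * cis t) ` {0..l1}"
      using ab by (intro image_eqI[of _ _ "s - a"]) (auto simp: w1_def l1_def cis_mult)
  qed
  then have up: "arc_count N \<theta> I \<le> arc_count N \<theta> ((\<lambda>t. w1 * cis t) ` {0..l1})"
    unfolding arc_count_def by (intro card_mono) auto
  have co: "cis x \<in> I \<or> cis x \<in> (\<lambda>t. w2 * cis t) ` {0..l2}" for x
  proof (rule disjCI)
    assume nz: "cis x \<notin> (\<lambda>t. w2 * cis t) ` {0..l2}"
    have "cmod (cis (x - a)) = 1" by simp
    then obtain t where t: "0 \<le> t" "t < 2 * pi" "cis (x - a) = cis t"
      by (metis complex_unimodular_polar complex_of_real_def cis.ctr)
    have x: "cis x = cis (a + t)"
      using t(3) by (metis cis_mult add.commute diff_add_cancel)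
    have False if "b \<le> a + t"
    proof -
      have "cis x = w2 * cis (a + t - b)" by (simp add: x w2_def cis_mult)
      then show False using nz that t by (auto simp: l2_def)
    qed
    moreover have False if "t = 0"
    proof -
      have "w2 * cis l2 = cis (a + 2 * pi)" by (simp add: w2_def l2_def cis_mult)
      also have "\<dots> = cis a * cis (2 * pi)" by (simp only: cis_mult)
      finally have "cis x = w2 * cis l2" using x that by simp
      then show False using nz ab by (auto simp: l2_def)
    qed
    ultimately have "a + t \<in> {a<..<b}" using t by force
    then show "cis x \<in> I" using x ab I by blast
  qed
  have "N = card {1..N}" by simp
  also have "\<dots> \<le> card ({j \<in> {1..N}. cis (\<theta> j) \<in> I} \<union>
                       {j \<in> {1..N}. cis (\<theta> j) \<in> (\<lambda>t. w2 * cis t) ` {0..l2}})"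
    using co by (intro card_mono) auto
  also have "\<dots> \<le> arc_count N \<theta> I + arc_count N \<theta> ((\<lambda>t. w2 * cis t) ` {0..l2})"
    unfolding arc_count_def by (rule card_Un_le)
  finally have lo: "N \<le> arc_count N \<theta> I + arc_count N \<theta> ((\<lambda>t. w2 * cis t) ` {0..l2})" .
  have l2: "l2 / (2 * pi) * real N = real N - L / (2 * pi) * real N"
    by (simp add: l2_def L field_simps)
  show thesis
  proof (cases "real (arc_count N \<theta> I) - L / (2 * pi) * real N \<ge> 0")
    case True
    show thesis
      by (rule that[of w1 l1]) (use True up ab in \<open>auto simp: w1_def l1_def L\<close>)
  next
    case False
    show thesis
      by (rule that[of w2 l2]) (use False lo l2 ab in \<open>auto simp: w2_def l2_def\<close>)
  qed
qed

lemma circle_arc_closed: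
  assumes "cmod w = 1" "0 \<le> l" "l \<le> 2 * pi"
  shows "circle_arc ((\<lambda>t. w * cis t) ` {0..l}) l"
proof -
  obtain a where w: "w = cis a"
    using assms(1) by (metis complex_unimodular_polar complex_of_real_def cis.ctr)
  have "(\<lambda>t. w * cis t) ` {0..l} = cis ` ((+) a ` {0..l})"
    unfolding image_image by (simp add: w cis_mult)
  also have "(+) a ` {0..l} = {a..a + l}"
    by (simp add: add.commute)
  finally show ?thesis
    unfolding circle_arc_def using assms
    by (intro exI[of _ a] exI[of _ "a + l"] exI[of _ "{a..a + l}"]) auto
qed

lemma closed_arc_maximum:
  obtains w l where "cmod w = 1" "0 \<le> l" "l \<le> 2 * pi"
    "\<And>v m. \<lbrakk>cmod v = 1; 0 \<le> m; m \<le> 2 * pi\<rbrakk> \<Longrightarrow>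
       real (arc_count N \<theta> ((\<lambda>t. v * cis t) ` {0..m})) - m / (2 * pi) * real N
         \<le> real (arc_count N \<theta> ((\<lambda>t. w * cis t) ` {0..l})) - l / (2 * pi) * real N"
proof -
  define K :: "(complex \<times> real) set" where "K = sphere 0 1 \<times> {0..2 * pi}"
  define hit where "hit p = {j \<in> {1..N}. cis (\<theta> j) \<in> (\<lambda>t. fst p * cis t) ` {0..snd p}}"
    for p :: "complex \<times> real"
  define f where "f p = real (card (hit p)) - snd p / (2 * pi) * real N"
    for p :: "complex \<times> real"
  define C where "C j = {p \<in> K. j \<in> hit p}" for j
  have K: "compact K" unfolding K_def by (intro compact_Times) auto
  have C: "compact (C j)" for j
  proof (cases "j \<in> {1..N}")
    case True
    let ?S = "{q \<in> {0..2 * pi} \<times> {0..2 * pi}. snd q \<le> fst q}"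
    let ?g = "\<lambda>q. (cis (\<theta> j) * cis (- snd q), fst q)"
    have S: "compact ?S"
    proof -
      have "?S = ({0..2 * pi} \<times> {0..2 * pi}) \<inter> {q. snd q \<le> fst q}" by auto
      moreover have "closed {q :: real \<times> real. snd q \<le> fst q}"
        by (intro closed_Collect_le continuous_on_fst continuous_on_snd continuous_on_id)
      moreover have "compact ({0..2 * pi} \<times> {0..2 * pi})"
        by (intro compact_Times compact_Icc)
      ultimately show ?thesis by (metis compact_Int_closed)
    qed
    have "C j = ?g ` ?S"
    proof (intro equalityI subsetI)
      fix p assume p: "p \<in> C j"
      then obtain t where t: "0 \<le> t" "t \<le> snd p" "cis (\<theta> j) = fst p * cis t"
        by (auto simp: C_def hit_def)
      have "p = ?g (snd p, t)" using t by (simp add: prod_eq_iff mult.assoc cis_mult)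
      moreover have "(snd p, t) \<in> ?S" using p t by (auto simp: C_def K_def)
      ultimately show "p \<in> ?g ` ?S" by blast
    next
      fix p assume "p \<in> ?g ` ?S"
      then obtain q where q: "q \<in> ?S" "p = ?g q" by blast
      have "cis (\<theta> j) = fst p * cis (snd q)" using q by (simp add: mult.assoc cis_mult)
      then show "p \<in> C j"
        using q True by (auto simp: C_def K_def hit_def norm_mult)
    qed
    moreover have "continuous_on ?S ?g" by (intro continuous_intros)
    ultimately show ?thesis using compact_continuous_image[OF _ S] by simp
  qed (auto simp: C_def hit_def)
  define Js where "Js = {J. J \<subseteq> {1..N} \<and> K \<inter> (\<Inter>j\<in>J. C j) \<noteq> {}}"
  have "\<exists>p \<in> K \<inter> (\<Inter>j\<in>J. C j). \<forall>q \<in> K \<inter> (\<Inter>j\<in>J. C j). snd p \<le> snd q" if "J \<in> Js" for J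
  proof -
    have "closed (\<Inter>j\<in>J. C j)"
      using C by (intro closed_INT ballI compact_imp_closed)
    then have "compact (K \<inter> (\<Inter>j\<in>J. C j))"
      using K by (rule compact_Int_closed[rotated])
    moreover have "K \<inter> (\<Inter>j\<in>J. C j) \<noteq> {}" using that by (simp add: Js_def)
    moreover have "continuous_on (K \<inter> (\<Inter>j\<in>J. C j)) snd"
      by (intro continuous_on_snd continuous_on_id)
    ultimately show ?thesis by (rule continuous_attains_inf)
  qed
  then have "\<forall>J\<in>Js. \<exists>p. p \<in> K \<inter> (\<Inter>j\<in>J. C j) \<and> (\<forall>q \<in> K \<inter> (\<Inter>j\<in>J. C j). snd p \<le> snd q)"
    by blast
  then obtain p where p_all: "\<forall>J\<in>Js. p J \<in> K \<inter> (\<Inter>j\<in>J. C j) \<and>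
      (\<forall>q \<in> K \<inter> (\<Inter>j\<in>J. C j). snd (p J) \<le> snd q)"
    by (rule bchoice[THEN exE])
  have p: "p J \<in> K \<inter> (\<Inter>j\<in>J. C j)"
      "\<And>q. q \<in> K \<inter> (\<Inter>j\<in>J. C j) \<Longrightarrow> snd (p J) \<le> snd q" if "J \<in> Js" for J
    using p_all that by blast+
  have hitJs: "q \<in> K \<inter> (\<Inter>j\<in>hit q. C j)" "hit q \<in> Js" if "q \<in> K" for q
  proof -
    show *: "q \<in> K \<inter> (\<Inter>j\<in>hit q. C j)" using that by (auto simp: C_def)
    have "hit q \<subseteq> {1..N}" by (auto simp: hit_def)
    then show "hit q \<in> Js" using * unfolding Js_def by blast
  qed
  have le: "f q \<le> f (p (hit q))" if "q \<in> K" for q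
  proof -
    have "hit q \<subseteq> hit (p (hit q))" using p(1)[OF hitJs(2)[OF that]] by (auto simp: C_def)
    then have "card (hit q) \<le> card (hit (p (hit q)))" by (intro card_mono) (auto simp: hit_def)
    moreover have "snd (p (hit q)) \<le> snd q" using p(2)[OF hitJs(2)[OF that] hitJs(1)[OF that]] .
    then have "snd (p (hit q)) / (2 * pi) * real N \<le> snd q / (2 * pi) * real N"
      by (intro mult_right_mono divide_right_mono) auto
    ultimately show ?thesis by (simp add: f_def)
  qed
  have "(1, 0) \<in> K" by (simp add: K_def)
  then have ne: "Js \<noteq> {}" using hitJs by blast
  have fin: "finite Js" by (rule finite_subset[of _ "Pow {1..N}"]) (auto simp: Js_def)
  obtain J where J: "J \<in> Js" "\<And>J'. J' \<in> Js \<Longrightarrow> f (p J') \<le> f (p J)"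
  proof -
    have "Max ((\<lambda>J. f (p J)) ` Js) \<in> (\<lambda>J. f (p J)) ` Js" using fin ne by (intro Max_in) auto
    then obtain J where "J \<in> Js" "f (p J) = Max ((\<lambda>J. f (p J)) ` Js)" by auto
    then show ?thesis using fin by (intro that[of J]) auto
  qed
  have "p J \<in> K" using p(1)[OF J(1)] by blast
  moreover have "f q \<le> f (p J)" if "q \<in> K" for q
    using le[OF that] J(2)[OF hitJs(2)[OF that]] by linarith
  ultimately show thesis
    by (intro that[of "fst (p J)" "snd (p J)"]) (auto simp: f_def hit_def K_def arc_count_def)
qed

lemma deviations_have_maximum:
  obtains M where "M \<in> arc_deviations N \<theta>" "\<And>d. d \<in> arc_deviations N \<theta> \<Longrightarrow> d \<le> M"
proof -
  let ?f = "\<lambda>w l. real (arc_count N \<theta> ((\<lambda>t. w * cis t) ` {0..l})) - l / (2 * pi) * real N"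
  obtain w l where wl: "cmod w = 1" "0 \<le> l" "l \<le> 2 * pi"
    and max: "\<And>v m. \<lbrakk>cmod v = 1; 0 \<le> m; m \<le> 2 * pi\<rbrakk> \<Longrightarrow> ?f v m \<le> ?f w l"
    using closed_arc_maximum by metis
  have "\<bar>?f w l\<bar> \<in> arc_deviations N \<theta>"
    unfolding arc_deviations_def using circle_arc_closed[OF wl] by blast
  moreover have "d \<le> \<bar>?f w l\<bar>" if d: "d \<in> arc_deviations N \<theta>" for d
  proof -
    obtain I L where IL: "circle_arc I L"
      "d = \<bar>real (arc_count N \<theta> I) - L / (2 * pi) * real N\<bar>"
      using d unfolding arc_deviations_def by blast
    obtain v m where "cmod v = 1" "0 \<le> m" "m \<le> 2 * pi" "d \<le> ?f v m"
      using deviation_le_closed_arc[OF IL(1)] IL(2) by metis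
    with max[of v m] show ?thesis by linarith
  qed
  ultimately show thesis using that by blast
qed

lemma discrepancy_attained: "discrepancy N \<theta> \<in> arc_deviations N \<theta>"
proof -
  obtain M where M: "M \<in> arc_deviations N \<theta>" "\<And>d. d \<in> arc_deviations N \<theta> \<Longrightarrow> d \<le> M"
    using deviations_have_maximum by blast
  then have "discrepancy N \<theta> = M" unfolding discrepancy_def by (rule cSup_eq_maximum)
  with M show ?thesis by simp
qed

lemma deviation_le_discrepancy:
  assumes "d \<in> arc_deviations N \<theta>"
  shows "d \<le> discrepancy N \<theta>"
proof -
  obtain M where M: "M \<in> arc_deviations N \<theta>" "\<And>d. d \<in> arc_deviations N \<theta> \<Longrightarrow> d \<le> M"
    using deviations_have_maximum by blast
  then have "discrepancy N \<theta> = M" unfolding discrepancy_def by (rule cSup_eq_maximum)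
  with M assms show ?thesis by simp
qed

end

theory Submission
  imports Defs "HOL-Complex_Analysis.Cauchy_Integral_Formula"
begin

text \<open>
  Moving every root radially onto the unit circle replaces \<open>\<bar>P\<bar> / sqrt \<bar>a\<^sub>0\<bar>\<close> by something smaller
  there, so all roots may be taken to be \<open>cis (\<theta> j)\<close>. If \<open>f\<close> is holomorphic on the disc, the sum of
  \<open>Re f\<close> over the roots minus its mean is \<open>- 1 / pi\<close> times the integral of
  \<open>ln \<bar>P\<bar> * Re (z * f' z)\<close> over the circle. As \<open>ln \<bar>P\<bar>\<close> has mean \<open>0\<close>, its \<open>L\<^sup>1\<close> norm is twice
  that of its positive part, so the deviation is at most \<open>4 * h * sup \<bar>Re (z * f' z)\<bar>\<close>.
  For \<open>Re f\<close> take the indicator of an arc lengthened by \<open>d\<close> at both ends, smoothed at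
  scale \<open>d\<close>, so that \<open>Re f = 1\<close> on the arc and \<open>Re f \<ge> 0\<close> elsewhere; then \<open>Re (z * f' z)\<close> is a difference
  of two translates of the conjugate of the smoothing density. A density whose conjugate function
  is at most \<open>2 / (pi * d)\<close> comes from the conformal map of the disc onto a half-strip. Finally
  \<open>d = 4 * sqrt (h / N)\<close> balances the smoothing error \<open>N * d / pi\<close> against \<open>16 * h / (pi * d)\<close>.
  To avoid singularities everything is done at radius \<open>s < 1\<close>, and \<open>s\<close> tends to \<open>1\<close>.
\<close>

subsection \<open>The half-strip map\<close>

text \<open>The function \<open>arsinh (tan y) - y\<close> has derivative
  \<open>1 / cos y - 1\<close>, which is nonnegative. The inequality lets
  \<open>\<eta> < d / 2\<close> imply \<open>sinh \<eta> < tan (d / 2)\<close>.\<close>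

lemma sinh_le_tan:
  fixes x :: real
  assumes "0 \<le> x" "x < pi / 2"
  shows "sinh x \<le> tan x"
proof -
  have "arsinh (tan 0) - 0 \<le> arsinh (tan x) - x"
  proof (rule DERIV_nonneg_imp_nondecreasing[of 0 x "\<lambda>y. arsinh (tan y) - y"])
    fix y assume y: "0 \<le> y" "y \<le> x"
    then have c: "cos y > 0" using assms by (intro cos_gt_zero_pi) auto
    have "((\<lambda>y. arsinh (tan y) - y) has_real_derivative
        1 / sqrt ((tan y)\<^sup>2 + 1) * inverse ((cos y)\<^sup>2) - 1) (at y)"
      using c by (intro DERIV_diff DERIV_ident DERIV_chain2[OF arsinh_real_has_field_derivative] DERIV_tan)
         auto
    moreover have "sqrt ((tan y)\<^sup>2 + 1) = 1 / cos y"
      using c tan_sec[of y] by (simp add: add.commute real_sqrt_unique inverse_eq_divide power_one_over)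
    moreover have "1 / cos y \<ge> 1" using c by simp
    ultimately show "\<exists>d. ((\<lambda>y. arsinh (tan y) - y) has_real_derivative d) (at y) \<and> 0 \<le> d"
      using c by (intro exI conjI) (auto simp: power2_eq_square field_simps)
  qed (use assms in auto)
  then have "x \<le> arsinh (tan x)" by simp
  then have "sinh x \<le> sinh (arsinh (tan x))" by (simp only: sinh_real_le_iff)
  then show ?thesis by (simp only: sinh_arsinh_real)
qed

lemma Re_cayley:
  assumes "z \<noteq> 1"
  shows "Re ((1 + z) / (1 - z)) = (1 - (cmod z)\<^sup>2) / (cmod (1 - z))\<^sup>2"
  unfolding cmod_power2 by (simp add: Re_divide power2_eq_square algebra_simps)

text \<open>For such \<open>w\<close> the logarithm in \<open>Arcsin\<close> is taken at a point of
  the right half-plane, which bounds the real part. The rest is the splitting of \<open>sin\<close>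
  into real and imaginary parts, where the cosine is positive.\<close>

lemma Arcsin_lower_half_plane:
  assumes "Im w < 0"
  shows "\<bar>Re (Arcsin w)\<bar> < pi / 2" "Im (Arcsin w) < 0"
    "Re w = sin (Re (Arcsin w)) * cosh (Im (Arcsin w))"
    "Im w = cos (Re (Arcsin w)) * sinh (Im (Arcsin w))"
proof -
  have "Re (\<i> * w + csqrt (1 - w\<^sup>2)) > 0"
    using isCont_Arcsin_lemma[of w] assms by fastforce
  then show re: "\<bar>Re (Arcsin w)\<bar> < pi / 2"
    unfolding Re_Arcsin by (rule Re_Ln_pos_lt_imp)
  show "Re w = sin (Re (Arcsin w)) * cosh (Im (Arcsin w))"
    using Re_sin[of "Arcsin w"] by (simp add: cosh_field_def)
  show im: "Im w = cos (Re (Arcsin w)) * sinh (Im (Arcsin w))"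
    using Im_sin[of "Arcsin w"] by (simp add: sinh_field_def)
  have "cos (Re (Arcsin w)) > 0"
    using re by (intro cos_gt_zero_pi) auto
  then show "Im (Arcsin w) < 0"
    using im assms by (simp add: mult_less_0_iff)
qed

text \<open>Write \<open>Arcsin w\<close> as \<open>a + \<i> * b\<close>. Then
  \<open>\<bar>sin a\<bar> \<le> \<bar>Re w\<bar> \<le> q\<close> keeps \<open>cos a\<close> above
  \<open>sqrt (1 - q\<^sup>2)\<close>, and
  \<open>- b \<le> sinh (- b) = - Im w / cos a\<close>.\<close>

lemma Im_Arcsin_lower_half_plane_bound:
  assumes "Im w < 0" "cmod w \<le> q" "q < 1"
  shows "- Im (Arcsin w) \<le> - Im w / sqrt (1 - q\<^sup>2)"
proof -
  let ?a = "Re (Arcsin w)" and ?b = "Im (Arcsin w)"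
  note A = Arcsin_lower_half_plane[OF assms(1)]
  have q: "0 \<le> q" using assms(2) norm_ge_zero order_trans by blast
  then have q1: "q\<^sup>2 < 1" using assms(3) by (simp add: abs_square_less_1)
  have "\<bar>sin ?a\<bar> * 1 \<le> \<bar>sin ?a\<bar> * cosh ?b"
    by (intro mult_left_mono cosh_real_ge_1) auto
  also have "\<dots> = \<bar>Re w\<bar>" by (simp add: A(3) abs_mult)
  also have "\<dots> \<le> q" using abs_Re_le_cmod assms(2) order_trans by blast
  finally have "(sin ?a)\<^sup>2 \<le> q\<^sup>2" using q by (simp add: abs_le_square_iff[symmetric])
  then have c2: "1 - q\<^sup>2 \<le> (cos ?a)\<^sup>2" by (simp add: cos_squared_eq)
  have cpos: "cos ?a > 0" using A(1) by (intro cos_gt_zero_pi) auto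
  have c: "sqrt (1 - q\<^sup>2) \<le> cos ?a"
    using c2 cpos by (simp add: real_le_lsqrt)
  have "- ?b \<le> sinh (- ?b)"
  proof -
    have "0 \<le> (sinh y - y :: real)" if "y \<ge> 0" for y
    proof -
      have "sinh 0 - 0 \<le> sinh y - y"
      proof (rule DERIV_nonneg_imp_nondecreasing[of 0 y "\<lambda>y. sinh y - y"])
        fix x :: real
        have "((\<lambda>y. sinh y - y) has_real_derivative cosh x - 1) (at x)"
          by (auto intro!: derivative_eq_intros)
        then show "\<exists>d. ((\<lambda>y. sinh y - y) has_real_derivative d) (at x) \<and> 0 \<le> d"
          using cosh_real_ge_1[of x] by force
      qed (use that in auto)
      then show ?thesis by simp
    qed
    from this[of "- ?b"] A(2) show ?thesis by simp
  qed
  then have "- ?b * sqrt (1 - q\<^sup>2) \<le> sinh (- ?b) * cos ?a"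
    using c A(2) q1 by (intro mult_mono) auto
  also have "\<dots> = - Im w" by (subst A(4)) simp
  finally show ?thesis using q1 by (simp add: field_simps)
qed

text \<open>The conformal map of the disc onto the half-strip
  \<open>{\<zeta>. 0 < Re \<zeta>, \<bar>Im \<zeta>\<bar> < 1 / (4 * \<eta>)}\<close> which sends \<open>1\<close> to infinity and \<open>0\<close> to \<open>1 / (2 * pi)\<close>;
  up to a rotation \<open>Arcsin\<close> is the inverse hyperbolic sine.\<close>
definition strip_map :: "real \<Rightarrow> complex \<Rightarrow> complex" where
  "strip_map \<eta> z =
     \<i> / of_real (2 * pi * \<eta>) * Arcsin (- \<i> * of_real (sinh \<eta>) * ((1 + z) / (1 - z)))"

context
  fixes \<eta> :: real
  assumes \<eta>: "\<eta> > 0"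
begin

text \<open>The Cayley transform sends the disc to the right half-plane, and the factor
  \<open>- \<i>\<close> turns this into the lower half-plane, away from the cuts of
  \<open>Arcsin\<close>.\<close>

lemma Im_strip_map_arg:
  assumes "cmod z < 1"
  shows "Im (- \<i> * of_real (sinh \<eta>) * ((1 + z) / (1 - z))) =
           - sinh \<eta> * ((1 - (cmod z)\<^sup>2) / (cmod (1 - z))\<^sup>2)"
    "Im (- \<i> * of_real (sinh \<eta>) * ((1 + z) / (1 - z))) < 0"
proof -
  have z: "z \<noteq> 1" using assms by auto
  have "Im (- \<i> * of_real (sinh \<eta>) * ((1 + z) / (1 - z))) = - sinh \<eta> * Re ((1 + z) / (1 - z))"
    by (simp only: mult.assoc minus_mult_left[symmetric] uminus_complex.sel Im_i_times Re_complex_of_real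
        Im_complex_of_real times_complex.sel) simp
  also have "\<dots> = - sinh \<eta> * ((1 - (cmod z)\<^sup>2) / (cmod (1 - z))\<^sup>2)"
    by (simp only: Re_cayley[OF z])
  finally show *: "Im (- \<i> * of_real (sinh \<eta>) * ((1 + z) / (1 - z))) =
           - sinh \<eta> * ((1 - (cmod z)\<^sup>2) / (cmod (1 - z))\<^sup>2)" .
  have "0 < (1 - (cmod z)\<^sup>2) / (cmod (1 - z))\<^sup>2"
    using assms z by (simp add: abs_square_less_1)
  then show "Im (- \<i> * of_real (sinh \<eta>) * ((1 + z) / (1 - z))) < 0"
    unfolding * using mult_pos_pos[of "sinh \<eta>"] \<eta> by fastforce
qed

lemma holomorphic_strip_map: "strip_map \<eta> holomorphic_on ball 0 1"
proof -
  let ?S = "{w. Im w < 0}"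
  have "Arcsin \<circ> (\<lambda>z. - \<i> * of_real (sinh \<eta>) * ((1 + z) / (1 - z))) holomorphic_on ball 0 1"
  proof (rule holomorphic_on_compose_gen)
    show "Arcsin holomorphic_on ?S" by (intro holomorphic_on_Arcsin) auto
    show "(\<lambda>z. - \<i> * of_real (sinh \<eta>) * ((1 + z) / (1 - z))) ` ball 0 1 \<subseteq> ?S"
      using Im_strip_map_arg(2) by (intro image_subsetI) simp
  qed (auto intro!: holomorphic_intros)
  then show ?thesis
    unfolding strip_map_def o_def by (intro holomorphic_on_mult holomorphic_on_const)
qed

lemma Re_strip_map:
  "Re (strip_map \<eta> z) = - Im (Arcsin (- \<i> * of_real (sinh \<eta>) * ((1 + z) / (1 - z)))) / (2 * pi * \<eta>)"
  and Im_strip_map: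
  "Im (strip_map \<eta> z) = Re (Arcsin (- \<i> * of_real (sinh \<eta>) * ((1 + z) / (1 - z)))) / (2 * pi * \<eta>)"
  by (simp_all add: strip_map_def Re_divide Im_divide power2_eq_square)

text \<open>The normalisation: by the mean value property the real part has integral 1 over the
  angles of every circle of radius below 1. It holds because
  \<open>sin (- \<i> * \<eta>) = - \<i> * sinh \<eta>\<close>.\<close>

lemma strip_map_0: "strip_map \<eta> 0 = of_real (1 / (2 * pi))"
proof -
  have "sin (- \<i> * of_real \<eta>) = - \<i> * of_real (sinh \<eta>)"
    by (simp add: complex_eq_iff Re_sin Im_sin sinh_field_def)
  then have "Arcsin (- \<i> * of_real (sinh \<eta>)) = - \<i> * of_real \<eta>"
    by (intro Arcsin_unique) auto
  then show ?thesis using \<eta> unfolding strip_map_def by (simp add: field_simps)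
qed

lemma Re_strip_map_nonneg: "cmod z < 1 \<Longrightarrow> 0 \<le> Re (strip_map \<eta> z)"
  unfolding Re_strip_map
  using \<eta> Arcsin_lower_half_plane(2)[OF Im_strip_map_arg(2), of z] by (intro divide_nonneg_pos) auto

text \<open>This bounds the conjugate of the density by the half-width of the strip; for
  \<open>\<eta> = pi * d / 8\<close> it is \<open>2 / (pi * d)\<close>.\<close>

lemma Im_strip_map_bound:
  assumes "cmod z < 1" shows "\<bar>Im (strip_map \<eta> z)\<bar> \<le> 1 / (4 * \<eta>)"
proof -
  have "\<bar>Im (strip_map \<eta> z)\<bar> \<le> (pi / 2) / (2 * pi * \<eta>)"
    unfolding Im_strip_map abs_divide
    using \<eta> Arcsin_lower_half_plane(1)[OF Im_strip_map_arg(2)[OF assms]]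
    by (intro frac_le) auto
  then show ?thesis by simp
qed

text \<open>At the boundary point of angle \<open>y\<close> the argument of \<open>Arcsin\<close> is
  the real number \<open>sinh \<eta> / tan (y / 2)\<close>. For \<open>cos y \<le> cos d\<close> its
  modulus is below 1, so \<open>Arcsin\<close> is real there and the density vanishes. The estimate
  makes this quantitative inside the disc.\<close>

lemma Re_strip_map_decay:
  assumes d: "0 < d" "d < pi / 2" and less: "sinh \<eta> < tan (d / 2)"
  obtains C where "\<And>t y. 0 \<le> t \<Longrightarrow> t < 1 \<Longrightarrow> cos y \<le> cos d \<Longrightarrow>
    Re (strip_map \<eta> (of_real t * cis y)) \<le> C * (1 - t)"
proof -
  define c where "c = cos d"
  define q where "q = sinh \<eta> / tan (d / 2)"
  have c: "0 < c" "c < 1" using d cos_gt_zero_pi[of d] cos_monotone_0_pi[of 0 d] by (auto simp: c_def)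
  have s: "sinh \<eta> > 0" using \<eta> by simp
  then have tan: "tan (d / 2) > 0" using less by linarith
  have q: "0 < q" "q < 1" using s tan less by (simp_all add: q_def)
  have tan2: "(tan (d / 2))\<^sup>2 = (1 - c) / (1 + c)"
  proof -
    have "(sin (d / 2))\<^sup>2 = (1 - c) / 2" "(cos (d / 2))\<^sup>2 = (1 + c) / 2"
      using cos_double_sin[of "d / 2"] cos_double_cos[of "d / 2"] by (auto simp: c_def)
    then have "(tan (d / 2))\<^sup>2 = ((1 - c) / 2) / ((1 + c) / 2)"
      by (simp only: tan_def power_divide)
    also have "\<dots> = (1 - c) / (1 + c)" using c by (simp add: divide_simps) (simp add: algebra_simps)
    finally show ?thesis .
  qed
  define C where "C = sinh \<eta> * (2 / (1 - c)) / sqrt (1 - q\<^sup>2) / (2 * pi * \<eta>)"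
  show thesis
  proof (rule that[of C])
    fix t y :: real assume t: "0 \<le> t" "t < 1" and y: "cos y \<le> cos d"
    define z where "z = of_real t * cis y"
    have z: "cmod z < 1" "cmod z = t" using t by (simp_all add: z_def norm_mult)
    have m: "(cmod (1 - z))\<^sup>2 = 1 + t\<^sup>2 - 2 * t * cos y" "(cmod (1 + z))\<^sup>2 = 1 + t\<^sup>2 + 2 * t * cos y"
    proof -
      have "(cmod (1 - z))\<^sup>2 = 1 + (cmod z)\<^sup>2 - 2 * Re z" "(cmod (1 + z))\<^sup>2 = 1 + (cmod z)\<^sup>2 + 2 * Re z"
        unfolding cmod_power2 by (simp_all add: power2_eq_square algebra_simps)
      moreover have "Re z = t * cos y" by (simp add: z_def)
      ultimately show "(cmod (1 - z))\<^sup>2 = 1 + t\<^sup>2 - 2 * t * cos y" "(cmod (1 + z))\<^sup>2 = 1 + t\<^sup>2 + 2 * t * cos y"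
        by (simp_all add: z(2))
    qed
    have tc: "t * cos y \<le> t * c" using t y by (intro mult_left_mono) (auto simp: c_def)
    \<comment> \<open>As \<open>c > 0\<close>, replacing \<open>2 * t\<close> by
      \<open>1 + t\<^sup>2\<close> puts the same factor \<open>1 + t\<^sup>2\<close> into the bounds
      for \<open>1 - z\<close> and \<open>1 + z\<close>. It cancels in the quotient, so
      \<open>cmod ?w \<le> q\<close> at every radius.\<close>
    have t2: "2 * t \<le> 1 + t\<^sup>2" using sum_squares_bound[of t 1] by simp
    then have t2c: "2 * t * c \<le> (1 + t\<^sup>2) * c" using c by (intro mult_right_mono) auto
    have lo: "(1 + t\<^sup>2) * (1 - c) \<le> (cmod (1 - z))\<^sup>2"
      using tc t2c by (simp add: m algebra_simps)
    have up: "(cmod (1 + z))\<^sup>2 \<le> (1 + t\<^sup>2) * (1 + c)"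
      using tc t2c by (simp add: m algebra_simps)
    have ge: "1 - c \<le> (cmod (1 - z))\<^sup>2"
    proof -
      have "1 * (1 - c) \<le> (1 + t\<^sup>2) * (1 - c)" using c by (intro mult_right_mono) auto
      with lo show ?thesis by simp
    qed
    let ?w = "- \<i> * of_real (sinh \<eta>) * ((1 + z) / (1 - z))"
    have "(cmod ?w)\<^sup>2 = (sinh \<eta>)\<^sup>2 * ((cmod (1 + z))\<^sup>2 / (cmod (1 - z))\<^sup>2)"
      by (simp add: norm_mult norm_divide power_mult_distrib power_divide)
    also have "\<dots> \<le> (sinh \<eta>)\<^sup>2 * (((1 + t\<^sup>2) * (1 + c)) / ((1 + t\<^sup>2) * (1 - c)))"
      using lo up c by (intro mult_left_mono frac_le) (auto intro!: mult_pos_pos add_pos_nonneg)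
    also have "\<dots> = (sinh \<eta>)\<^sup>2 * ((1 + c) / (1 - c))"
    proof -
      have "1 + t\<^sup>2 \<noteq> 0" by (metis add_pos_nonneg less_irrefl zero_le_power2 zero_less_one)
      then show ?thesis by simp
    qed
    also have "\<dots> = q\<^sup>2"
      unfolding q_def power_divide tan2 using c by simp
    finally have "cmod ?w \<le> q" using q by (simp add: power_mono_iff)
    from Im_Arcsin_lower_half_plane_bound[OF Im_strip_map_arg(2)[OF z(1)] this q(2)]
    have "- Im (Arcsin ?w) \<le> sinh \<eta> * ((1 - t\<^sup>2) / (cmod (1 - z))\<^sup>2) / sqrt (1 - q\<^sup>2)"
      unfolding Im_strip_map_arg(1)[OF z(1)] z(2) by simp
    also have "\<dots> \<le> sinh \<eta> * ((2 * (1 - t)) / (1 - c)) / sqrt (1 - q\<^sup>2)"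
    proof -
      have "1 - t\<^sup>2 \<le> 2 * (1 - t)" using t2 by simp
      moreover have "0 \<le> 1 - t\<^sup>2" "0 \<le> 1 - q\<^sup>2" using t q by (auto simp: power_le_one)
      ultimately show ?thesis
        using ge c s by (intro divide_right_mono mult_left_mono frac_le) auto
    qed
    finally have "- Im (Arcsin ?w) / (2 * pi * \<eta>)
        \<le> sinh \<eta> * ((2 * (1 - t)) / (1 - c)) / sqrt (1 - q\<^sup>2) / (2 * pi * \<eta>)"
      using \<eta> by (intro divide_right_mono) auto
    also have "\<dots> = C * (1 - t)" by (simp only: C_def times_divide_eq_left times_divide_eq_right mult.assoc)
    finally show "Re (strip_map \<eta> (of_real t * cis y)) \<le> C * (1 - t)"
      unfolding Re_strip_map z_def .
  qed
qed

end

subsection \<open>Pairing with the logarithm of a linear factor\<close>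

lemma has_integral_circle:
  assumes "(g has_contour_integral 2 * of_real pi * \<i> * I) (circlepath 0 1)"
  shows "((\<lambda>t. g (cis t) * cis t) has_integral of_real (2 * pi) * I) {0..2 * pi}"
proof -
  have "((\<lambda>t. g (0 + 1 * cis t) * 1 * \<i> * cis t) has_integral 2 * of_real pi * \<i> * I) {0..2 * pi}"
    using assms has_contour_integral_part_circlepath_iff[of 0 "2 * pi" g "2 * of_real pi * \<i> * I" 0 1]
    unfolding circlepath_def by simp
  from has_integral_mult_right[OF this, of "- \<i>"] show ?thesis
    by (simp add: algebra_simps)
qed

lemma has_integral_circle_mean:
  assumes "h holomorphic_on ball 0 R" "R > 1"
  shows "((\<lambda>t. h (cis t)) has_integral of_real (2 * pi) * h 0) {0..2 * pi}"
proof -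
  have "h holomorphic_on cball 0 1"
    using assms by (auto intro: holomorphic_on_subset)
  from Cauchy_integral_circlepath_simple[OF this, of 0]
  have "((\<lambda>z. h z / z) has_contour_integral 2 * of_real pi * \<i> * h 0) (circlepath 0 1)"
    by simp
  from has_integral_circle[OF this] show ?thesis by simp
qed

lemma Ln_one_minus:
  assumes "cmod w < 1"
  shows "1 - w \<notin> \<real>\<^sub>\<le>\<^sub>0" "cnj (Ln (1 - w)) = Ln (1 - cnj w)"
proof -
  have "Re (1 - w) > 0"
    using assms complex_Re_le_cmod[of w] by simp
  then show *: "1 - w \<notin> \<real>\<^sub>\<le>\<^sub>0" by (auto simp: complex_nonpos_Reals_iff)
  then show "cnj (Ln (1 - w)) = Ln (1 - cnj w)" by (simp add: cnj_Ln)
qed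

text \<open>On the circle \<open>cnj (Ln (1 - cnj u * z)) = Ln (1 - u / z)\<close>, and integrating
  \<open>F' * Ln (1 - u / z)\<close> by parts gives Cauchy integrals at \<open>u\<close> and \<open>0\<close>.\<close>
lemma has_integral_deriv_cnj_Ln:
  assumes F: "F holomorphic_on ball 0 R" and R: "R > 1" and u: "cmod u < 1"
  shows "((\<lambda>t. cis t * deriv F (cis t) * cnj (Ln (1 - cnj u * cis t)))
           has_integral of_real (2 * pi) * (F 0 - F u)) {0..2 * pi}"
proof -
  \<comment> \<open>On this annulus \<open>cmod (u / z) < 1\<close>, so
    \<open>F z * Ln (1 - u / z)\<close> is single-valued and its derivative integrates to 0 over the
    unit circle.\<close>
  let ?S = "ball 0 R - cball 0 (cmod u)"
  have S: "open ?S" by auto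
  have path: "path_image (circlepath 0 1) \<subseteq> ?S" using R u by auto
  let ?g = "\<lambda>z. F z * (1 / (z - u) - 1 / z) + deriv F z * Ln (1 - u / z)"
  have der: "((\<lambda>z. F z * Ln (1 - u / z)) has_field_derivative ?g z) (at z within ?S)" if z: "z \<in> ?S" for z
  proof -
    have nz: "z \<noteq> 0" "z \<noteq> u" and lt: "cmod (u / z) < 1" using z u
      by (auto simp: norm_divide divide_less_eq_1)
    have "(F has_field_derivative deriv F z) (at z)"
      using F z by (intro holomorphic_derivI[of _ "ball 0 R"]) auto
    moreover have "((\<lambda>z. Ln (1 - u / z)) has_field_derivative 1 / (z - u) - 1 / z) (at z)"
    proof -
      have "((\<lambda>z. 1 - u / z) has_field_derivative u / (z * z)) (at z)"
        using nz by (auto intro!: derivative_eq_intros)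
      moreover have "(Ln has_field_derivative inverse (1 - u / z)) (at (1 - u / z))"
        by (rule has_field_derivative_Ln[OF Ln_one_minus(1)[OF lt]])
      ultimately have "((\<lambda>z. Ln (1 - u / z)) has_field_derivative
          inverse (1 - u / z) * (u / (z * z))) (at z)"
        by (intro DERIV_chain2)
      moreover have "inverse (1 - u / z) * (u / (z * z)) = 1 / (z - u) - 1 / z"
        using nz by (simp add: field_simps)
      ultimately show ?thesis by simp
    qed
    ultimately have "((\<lambda>z. F z * Ln (1 - u / z)) has_field_derivative
        F z * (1 / (z - u) - 1 / z) + deriv F z * Ln (1 - u / z)) (at z)"
      by (rule DERIV_mult')
    then show ?thesis by (rule has_field_derivative_at_within)
  qed
  have A: "(?g has_contour_integral 0) (circlepath 0 1)"
    using contour_integral_primitive[OF der valid_path_circlepath path] by simp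
  have hol: "F holomorphic_on cball 0 1"
    using F R by (auto intro: holomorphic_on_subset)
  have B: "((\<lambda>z. F z / (z - u) - F z / (z - 0)) has_contour_integral
      2 * of_real pi * \<i> * F u - 2 * of_real pi * \<i> * F 0) (circlepath 0 1)"
    by (intro has_contour_integral_diff Cauchy_integral_circlepath_simple hol) (use u in auto)
  have "((\<lambda>z. deriv F z * Ln (1 - u / z)) has_contour_integral
      2 * of_real pi * \<i> * (F 0 - F u)) (circlepath 0 1)"
    using has_contour_integral_diff[OF A B] by (simp add: algebra_simps)
  from has_integral_circle[OF this]
  have "((\<lambda>t. deriv F (cis t) * Ln (1 - u / cis t) * cis t)
           has_integral of_real (2 * pi) * (F 0 - F u)) {0..2 * pi}" .
  moreover have "deriv F (cis t) * Ln (1 - u / cis t) * cis t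
      = cis t * deriv F (cis t) * cnj (Ln (1 - cnj u * cis t))" for t
  proof -
    have "cmod (cnj u * cis t) < 1" using u by (simp add: norm_mult)
    moreover have "cnj (cis t) = 1 / cis t" by (simp add: cis_cnj cis_inverse flip: inverse_eq_divide)
    ultimately show ?thesis using Ln_one_minus(2)[of "cnj u * cis t"] by simp
  qed
  ultimately show ?thesis by simp
qed

text \<open>On the unit circle \<open>z - u\<close> and \<open>1 - cnj u * z\<close> have equal
  modulus, and the latter has no zero in the closed disc. The logarithm thus becomes the real part
  of a holomorphic function.\<close>

lemma ln_cmod_circle:
  assumes "cmod u < 1"
  shows "ln (cmod (cis t - u)) = Re (Ln (1 - cnj u * cis t))"
proof -
  have "cmod (cnj u * cis t) < 1" using assms by (simp add: norm_mult)
  then have "1 - cnj u * cis t \<noteq> 0" using Ln_one_minus(1) by force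
  moreover have "cmod (cis t - u) = cmod (1 - cnj u * cis t)"
  proof -
    have "cis t - u = cis t * cnj (1 - cnj u * cis t)"
      by (simp add: algebra_simps cis_cnj cis_mult)
    then show ?thesis by (metis norm_mult complex_mod_cnj norm_cis mult_1)
  qed
  ultimately show ?thesis by simp
qed

text \<open>The first claim is the mean value property with \<open>Ln 1 = 0\<close>. For the second,
  \<open>2 * Re X * Re Y = Re (X * Y + X * cnj Y)\<close>: the first product is holomorphic and
  vanishes at 0, the second is the integral by parts above.\<close>

lemma has_integral_ln_cmod_circle:
  assumes "cmod u < 1"
  shows "((\<lambda>t. ln (cmod (cis t - u))) has_integral 0) {0..2 * pi}"
  and "F holomorphic_on ball 0 R \<Longrightarrow> R > 1 \<Longrightarrow>
   ((\<lambda>t. Re (cis t * deriv F (cis t)) * ln (cmod (cis t - u)))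
      has_integral pi * Re (F 0 - F u)) {0..2 * pi}"
proof -
  \<comment> \<open>The radius up to which \<open>cmod (cnj u * z) < 1\<close>; for
    \<open>u = 0\<close> any value above 1 serves.\<close>
  define \<rho> where "\<rho> = (if u = 0 then 2 else 1 / cmod u)"
  have \<rho>: "\<rho> > 1" using assms by (auto simp: \<rho>_def)
  have less: "cmod (cnj u * z) < 1" if "z \<in> ball 0 \<rho>" for z
    using that by (cases "u = 0") (auto simp: \<rho>_def norm_mult field_simps)
  have hol: "(\<lambda>z. Ln (1 - cnj u * z)) holomorphic_on ball 0 \<rho>"
    using Ln_one_minus(1)[OF less] by (intro holomorphic_intros) auto
  from has_integral_linear[OF has_integral_circle_mean[OF hol \<rho>] bounded_linear_Re]
  show "((\<lambda>t. ln (cmod (cis t - u))) has_integral 0) {0..2 * pi}"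
    by (simp add: o_def ln_cmod_circle[OF assms])
  assume F: "F holomorphic_on ball 0 R" and R: "R > 1"
  let ?X = "\<lambda>z. z * deriv F z" and ?Y = "\<lambda>z. Ln (1 - cnj u * z)"
  have "(\<lambda>z. ?X z * ?Y z) holomorphic_on ball 0 (min R \<rho>)"
    by (intro holomorphic_intros holomorphic_on_subset[OF hol] holomorphic_on_subset[OF holomorphic_deriv[OF F]])
       (use Ln_one_minus(1)[OF less] in auto)
  then have "((\<lambda>t. ?X (cis t) * ?Y (cis t)) has_integral of_real (2 * pi) * 0) {0..2 * pi}"
    using has_integral_circle_mean[of "\<lambda>z. ?X z * ?Y z" "min R \<rho>"] R \<rho> by simp
  from has_integral_add[OF this has_integral_deriv_cnj_Ln[OF F R assms]]
  have "((\<lambda>t. ?X (cis t) * ?Y (cis t) + ?X (cis t) * cnj (?Y (cis t)))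
      has_integral of_real (2 * pi) * (F 0 - F u)) {0..2 * pi}" by simp
  from has_integral_mult_right[OF has_integral_linear[OF this bounded_linear_Re], of "1 / 2"]
  show "((\<lambda>t. Re (cis t * deriv F (cis t)) * ln (cmod (cis t - u)))
      has_integral pi * Re (F 0 - F u)) {0..2 * pi}"
    by (simp add: o_def ln_cmod_circle[OF assms] algebra_simps)
qed

subsection \<open>Smoothed arcs\<close>

text \<open>The real part of \<open>f\<close> is the Poisson extension of a smoothed indicator function of the arc
  from \<open>a\<close> to \<open>b\<close>, the boundary values of \<open>Re \<Phi>\<close> being the smoothing density. With
  \<open>V t' = Re \<Phi>\<close> it equals \<open>V t (x - a) - V t (x - b)\<close>.\<close>
lemma smoothed_arc:
  fixes \<Phi> :: "complex \<Rightarrow> complex"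
  assumes hol: "\<Phi> holomorphic_on ball 0 1" and \<Phi>0: "\<Phi> 0 = of_real (1 / (2 * pi))"
    and nonneg: "\<And>z. cmod z < 1 \<Longrightarrow> 0 \<le> Re (\<Phi> z)"
    and bound: "\<And>z. cmod z < 1 \<Longrightarrow> \<bar>Im (\<Phi> z)\<bar> \<le> M"
    and d: "0 < d" "d < pi"
    and decay: "\<And>t y. 0 \<le> t \<Longrightarrow> t < 1 \<Longrightarrow> cos y \<le> cos d \<Longrightarrow> Re (\<Phi> (of_real t * cis y)) \<le> C * (1 - t)"
    and ab: "a \<le> b"
  obtains f where "f holomorphic_on ball 0 1" "Re (f 0) = (b - a) / (2 * pi)"
    "\<And>z. cmod z < 1 \<Longrightarrow> \<bar>Re (z * deriv f z)\<bar> \<le> 2 * M"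
    "\<And>t x. 0 \<le> t \<Longrightarrow> t < 1 \<Longrightarrow> 0 \<le> Re (f (of_real t * cis x))"
    "\<And>t x. 0 \<le> t \<Longrightarrow> t < 1 \<Longrightarrow> a + d \<le> x \<Longrightarrow> x \<le> b - d \<Longrightarrow>
       1 - 2 * pi * C * (1 - t) \<le> Re (f (of_real t * cis x))"
proof -
  \<comment> \<open>The singularity at 0 is removable, so \<open>h\<close> has a primitive
    \<open>H\<close> with \<open>z * H' z = \<Phi> z - \<Phi> 0\<close>.\<close>
  define h where "h z = (if z = 0 then deriv \<Phi> 0 else (\<Phi> z - \<Phi> 0) / (z - 0))" for z
  obtain H where H': "\<And>z. z \<in> ball 0 1 \<Longrightarrow> (H has_field_derivative h z) (at z within ball 0 1)"
    using holomorphic_convex_primitive'[OF convex_ball open_ball pole_lemma_open[OF hol open_ball, of 0]]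
    unfolding h_def by blast
  have H: "(H has_field_derivative h z) (at z)" if "cmod z < 1" for z
    using H'[of z] that at_within_open[of z "ball 0 1"] by simp
  have h: "z * h z = \<Phi> z - \<Phi> 0" for z
    by (simp add: h_def)
  \<comment> \<open>Differentiating \<open>Im H\<close> in the angle gives
    \<open>Re \<Phi> - 1 / (2 * pi)\<close>; the linear term restores the mean.\<close>
  define V where "V t y = Im (H (of_real t * cis y)) + y / (2 * pi)" for t y
  have V': "(V t has_real_derivative Re (\<Phi> (of_real t * cis y))) (at y)"
    if t: "0 \<le> t" "t < 1" for t y
  proof -
    let ?z = "of_real t * cis y"
    have z: "cmod ?z < 1" using t by (simp add: norm_mult)
    have "((\<lambda>y. of_real t * cis y) has_vector_derivative \<i> * ?z) (at y)"
      by (auto intro!: derivative_eq_intros simp: has_vector_derivative_def scaleR_conv_of_real)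
    from field_vector_diff_chain_at[OF this H[OF z]]
    have "((\<lambda>y. H (of_real t * cis y)) has_vector_derivative \<i> * (?z * h ?z)) (at y)"
      by (simp add: o_def mult.assoc)
    from bounded_linear.has_vector_derivative[OF bounded_linear_Im this]
    have "((\<lambda>y. Im (H (of_real t * cis y))) has_real_derivative Re (\<Phi> ?z) - 1 / (2 * pi)) (at y)"
      unfolding h \<Phi>0 by (simp add: has_real_derivative_iff_has_vector_derivative)
    from DERIV_add[OF this DERIV_cdivide[OF DERIV_ident, of "2 * pi"]]
    show ?thesis unfolding V_def by simp
  qed
  have mono: "V t x \<le> V t y" if t: "0 \<le> t" "t < 1" and "x \<le> y" for t x y
    using V'[OF t] nonneg[of "of_real t * cis _"] t
    by (intro DERIV_nonneg_imp_nondecreasing[OF \<open>x \<le> y\<close>]) (fastforce simp: norm_mult)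
  \<comment> \<open>Over a full turn \<open>V t\<close> gains exactly 1. From \<open>d\<close> to
    \<open>2 * pi - d\<close> it gains little by \<open>decay\<close>, so nearly all of the increase
    lies between \<open>- d\<close> and \<open>d\<close>.\<close>
  have step: "1 - 2 * pi * C * (1 - t) \<le> V t d - V t (- d)" if t: "0 \<le> t" "t < 1" for t
  proof -
    have "V t (2 * pi - d) = V t (- d) + 1"
    proof -
      have "cis (2 * pi - d) = cis (- d)" by (simp add: complex_eq_iff)
      then show ?thesis by (simp only: V_def) (simp add: field_simps)
    qed
    moreover have "V t (2 * pi - d) - V t d \<le> 2 * pi * (C * (1 - t))"
    proof -
      obtain y where y: "d < y" "y < 2 * pi - d"
        and eq: "V t (2 * pi - d) - V t d = (2 * pi - d - d) * Re (\<Phi> (of_real t * cis y))"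
        using MVT2[of d "2 * pi - d" "V t" "\<lambda>y. Re (\<Phi> (of_real t * cis y))"] V'[OF t] d by auto
      have "cos y \<le> cos d"
      proof (cases "y \<le> pi")
        case False
        have "cos (2 * pi - y) \<le> cos d" using y d False by (intro cos_monotone_0_pi_le) auto
        then show ?thesis by simp
      qed (use y d in \<open>auto intro: cos_monotone_0_pi_le\<close>)
      then have "Re (\<Phi> (of_real t * cis y)) \<le> C * (1 - t)" using decay t by blast
      moreover have "0 \<le> Re (\<Phi> (of_real t * cis y))"
        using t by (intro nonneg) (simp add: norm_mult)
      ultimately show ?thesis unfolding eq using d by (intro mult_mono) auto
    qed
    ultimately show ?thesis by simp
  qed
  \<comment> \<open>The factor \<open>- \<i>\<close> makes \<open>Re f\<close> a difference of
    values of \<open>Im H\<close>, and the constant supplies the linear terms of \<open>V\<close>.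
    Moreover \<open>z * f' z\<close> is \<open>- \<i>\<close> times a difference of two rotated
    copies of \<open>\<Phi>\<close>, so its real part involves only
    \<open>Im \<Phi>\<close>.\<close>
  define f where "f z = of_real ((b - a) / (2 * pi)) - \<i> * (H (z * cis (- a)) - H (z * cis (- b)))" for z
  have f': "(f has_field_derivative - \<i> * (h (z * cis (- a)) * cis (- a) - h (z * cis (- b)) * cis (- b))) (at z)"
    if "cmod z < 1" for z
  proof -
    have rot: "((\<lambda>z. H (z * cis c)) has_field_derivative h (z * cis c) * cis c) (at z)" for c
      by (rule DERIV_chain2[OF H]) (use that in \<open>auto simp: norm_mult intro!: derivative_eq_intros\<close>)
    show ?thesis
      unfolding f_def using DERIV_diff[OF DERIV_const DERIV_cmult[OF DERIV_diff[OF rot rot]]] by simp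
  qed
  have Re_f: "Re (f (of_real t * cis x)) = V t (x - a) - V t (x - b)" for t x
    by (simp add: f_def V_def mult.assoc cis_mult diff_divide_distrib)
  show thesis
  proof (rule that[of f])
    show "f holomorphic_on ball 0 1"
      unfolding holomorphic_on_open[OF open_ball] by (intro ballI exI) (rule f', simp)
    show "Re (f 0) = (b - a) / (2 * pi)" by (simp add: f_def)
    show "\<bar>Re (z * deriv f z)\<bar> \<le> 2 * M" if z: "cmod z < 1" for z
    proof -
      have z2: "cmod (z * cis c) < 1" for c using z by (simp add: norm_mult)
      have "z * deriv f z = - \<i> * (z * cis (- a) * h (z * cis (- a)) - z * cis (- b) * h (z * cis (- b)))"
        unfolding DERIV_imp_deriv[OF f'[OF z]] by (simp add: algebra_simps)
      also have "\<dots> = - \<i> * (\<Phi> (z * cis (- a)) - \<Phi> (z * cis (- b)))"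
        by (simp only: h) simp
      finally have "Re (z * deriv f z) = Im (\<Phi> (z * cis (- a))) - Im (\<Phi> (z * cis (- b)))"
        by simp
      then show ?thesis using bound[OF z2, of "- a"] bound[OF z2, of "- b"] by linarith
    qed
    show "0 \<le> Re (f (of_real t * cis x))" if "0 \<le> t" "t < 1" for t x
      unfolding Re_f using mono[OF that, of "x - b" "x - a"] ab by simp
    show "1 - 2 * pi * C * (1 - t) \<le> Re (f (of_real t * cis x))"
      if t: "0 \<le> t" "t < 1" and "a + d \<le> x" "x \<le> b - d" for t x
      unfolding Re_f
      using mono[OF t, of d "x - a"] mono[OF t, of "x - b" "- d"] step[OF t] that by linarith
  qed
qed

section \<open>The positive part of the logarithm and sums over the roots\<close>

lemma log_plus_eq: "log_plus x = ln (max 1 x)"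
  by (auto simp: log_plus_def max_def)

lemma log_plus_mono: "x \<le> y \<Longrightarrow> log_plus x \<le> log_plus y"
  unfolding log_plus_eq by (subst ln_le_cancel_iff) auto

lemma log_plus_nonneg: "0 \<le> log_plus x"
  by (simp add: log_plus_def)

text \<open>Continuity also holds where \<open>g\<close> vanishes, so roots on the unit circle do no
  harm.\<close>

lemma continuous_on_log_plus [continuous_intros]:
  "continuous_on S g \<Longrightarrow> continuous_on S (\<lambda>x. log_plus (g x))"
  unfolding log_plus_eq by (intro continuous_intros) (auto simp: max_def)

text \<open>The radius \<open>s\<close> enters twice, in the roots
  \<open>s * cis (\<theta> j)\<close> and in \<open>F z = f (s * z)\<close>, whence
  \<open>s\<^sup>2\<close>. Then \<open>F\<close> is holomorphic beyond the unit circle and the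
  logarithms have no singularity on it.\<close>

lemma sum_deviation_le:
  fixes \<theta> :: "'a \<Rightarrow> real"
  assumes f: "f holomorphic_on ball 0 1"
    and bound: "\<And>z. cmod z < 1 \<Longrightarrow> \<bar>Re (z * deriv f z)\<bar> \<le> B"
    and s: "0 < s" "s < 1"
  shows "(\<Sum>j\<in>J. Re (f (of_real (s\<^sup>2) * cis (\<theta> j)) - f 0))
    \<le> 2 * B / pi * integral {0..2 * pi} (\<lambda>t. log_plus (\<Prod>j\<in>J. cmod (cis t - of_real s * cis (\<theta> j))))"
proof (cases "finite J")
  case J: True
  define u where "u j = of_real s * cis (\<theta> j)" for j
  have u: "cmod (u j) < 1" for j using s by (simp add: u_def norm_mult)
  define F where "F z = f (of_real s * z)" for z
  have scaled: "of_real s * z \<in> ball 0 1" if "z \<in> ball 0 (1 / s)" for z :: complex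
    using that s by (simp add: norm_mult dist_norm field_simps)
  have F: "F holomorphic_on ball 0 (1 / s)"
    unfolding F_def using scaled
    by (intro holomorphic_on_compose_gen[OF _ f, unfolded o_def] holomorphic_intros) auto
  have R: "1 / s > 1" using s by simp
  define \<Lambda> where "\<Lambda> t = (\<Sum>j\<in>J. ln (cmod (cis t - u j)))" for t
  define W where "W t = (\<Prod>j\<in>J. cmod (cis t - u j))" for t
  define G where "G t = Re (cis t * deriv F (cis t))" for t
  have pos: "cmod (cis t - u j) > 0" for t j using u[of j] norm_cis[of t] by (auto simp del: norm_cis)
  then have \<Lambda>: "\<Lambda> t = ln (W t)" for t
    unfolding \<Lambda>_def W_def using J by (subst ln_prod) auto
  have Wpos: "W t > 0" for t unfolding W_def using pos by (intro prod_pos) auto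
  have mean: "(\<Lambda> has_integral 0) {0..2 * pi}"
    unfolding \<Lambda>_def using has_integral_sum[OF J has_integral_ln_cmod_circle(1)[OF u]] by simp
  have "((\<lambda>t. \<Sum>j\<in>J. G t * ln (cmod (cis t - u j))) has_integral (\<Sum>j\<in>J. pi * Re (F 0 - F (u j)))) {0..2 * pi}"
    unfolding G_def by (intro has_integral_sum J has_integral_ln_cmod_circle(2)[OF u F R])
  then have pair: "((\<lambda>t. - (G t * \<Lambda> t)) has_integral - (\<Sum>j\<in>J. pi * Re (F 0 - F (u j)))) {0..2 * pi}"
    unfolding \<Lambda>_def sum_distrib_left by (rule has_integral_neg)
  have "continuous_on {0..2 * pi} (\<lambda>t. log_plus (W t))"
    unfolding W_def by (intro continuous_intros)
  then have W: "((\<lambda>t. log_plus (W t)) has_integral integral {0..2 * pi} (\<lambda>t. log_plus (W t))) {0..2 * pi}"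
    by (intro integrable_integral integrable_continuous_real)
  \<comment> \<open>The integrand is \<open>B * \<bar>\<Lambda> t\<bar>\<close>, written so that the
    mean 0 of \<open>\<Lambda>\<close> leaves only the positive part.\<close>
  have "((\<lambda>t. 2 * B * log_plus (W t) - B * \<Lambda> t) has_integral
      2 * B * integral {0..2 * pi} (\<lambda>t. log_plus (W t)) - B * 0) {0..2 * pi}"
    by (intro has_integral_diff has_integral_mult_right W mean)
  with pair have "- (\<Sum>j\<in>J. pi * Re (F 0 - F (u j)))
      \<le> 2 * B * integral {0..2 * pi} (\<lambda>t. log_plus (W t)) - B * 0"
  proof (rule has_integral_le)
    fix t
    have c: "cmod (of_real s * cis t) < 1" using s by (simp add: norm_mult)
    have "(F has_field_derivative deriv f (of_real s * cis t) * of_real s) (at (cis t))"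
      unfolding F_def
      by (rule DERIV_chain2[OF holomorphic_derivI[OF f open_ball]])
         (use c in \<open>auto intro!: derivative_eq_intros\<close>)
    then have eq: "cis t * deriv F (cis t) = of_real s * cis t * deriv f (of_real s * cis t)"
      by (simp add: DERIV_imp_deriv)
    have "\<bar>G t\<bar> \<le> B" unfolding G_def eq by (rule bound[OF c])
    then have "\<bar>G t\<bar> * \<bar>\<Lambda> t\<bar> \<le> B * \<bar>\<Lambda> t\<bar>" by (intro mult_right_mono) auto
    then have "- (G t * \<Lambda> t) \<le> B * \<bar>\<Lambda> t\<bar>" by (simp add: flip: abs_mult)
    also have "\<bar>\<Lambda> t\<bar> = 2 * log_plus (W t) - \<Lambda> t"
      unfolding \<Lambda> log_plus_def using Wpos[of t] by simp
    finally show "- (G t * \<Lambda> t) \<le> 2 * B * log_plus (W t) - B * \<Lambda> t"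
      by (simp add: algebra_simps)
  qed
  then have "pi * (\<Sum>j\<in>J. Re (F (u j) - F 0)) \<le> 2 * B * integral {0..2 * pi} (\<lambda>t. log_plus (W t))"
    by (simp add: sum_distrib_left sum_negf[symmetric] algebra_simps)
  moreover have "F (u j) = f (of_real (s\<^sup>2) * cis (\<theta> j))" "F 0 = f 0" for j
    by (simp_all add: F_def u_def power2_eq_square mult.assoc)
  ultimately show ?thesis
    by (simp add: W_def u_def field_simps)
\<comment> \<open>For infinite \<open>J\<close> the sum is 0 and the product is 1, whose
  \<open>log_plus\<close> is 0.\<close>
qed (simp add: log_plus_def)

subsection \<open>Counting roots in an arc\<close>

text \<open>The smoothed indicator of the arc from \<open>c - d\<close> to \<open>c + l + d\<close>
  is nearly 1 at the roots in the arc and nonnegative at the others, so its sum over all roots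
  bounds the count. Its mean gives the main term.\<close>

lemma arc_count_le:
  assumes d: "0 < d" "d < pi / 2" and l: "0 \<le> l"
  shows "real (arc_count N \<theta> ((\<lambda>t. cis c * cis t) ` {0..l}))
    \<le> (l + 2 * d) / (2 * pi) * real N + 8 / (pi * d) *
       (1 / pi * integral {0..2 * pi} (\<lambda>t. log_plus (\<Prod>j\<in>{1..N}. cmod (cis t - cis (\<theta> j)))))"
proof -
  \<comment> \<open>Any \<open>\<eta>\<close> with \<open>sinh \<eta> < tan (d / 2)\<close> would
    do; this one makes \<open>M = 2 / (pi * d)\<close>, which leads to the constant
    \<open>8 / pi\<close> of the theorem.\<close>
  define \<eta> where "\<eta> = pi * d / 8"
  have \<eta>: "\<eta> > 0" using d by (simp add: \<eta>_def)
  have less: "sinh \<eta> < tan (d / 2)"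
  proof -
    have "\<eta> < d / 2" using d pi_less_4 by (simp add: \<eta>_def)
    then have "sinh \<eta> < sinh (d / 2)" by simp
    also have "\<dots> \<le> tan (d / 2)" using d by (intro sinh_le_tan) auto
    finally show ?thesis .
  qed
  obtain C where C: "\<And>t y. 0 \<le> t \<Longrightarrow> t < 1 \<Longrightarrow> cos y \<le> cos d \<Longrightarrow>
      Re (strip_map \<eta> (of_real t * cis y)) \<le> C * (1 - t)"
    using Re_strip_map_decay[OF \<eta> d less] by blast
  define M where "M = 1 / (4 * \<eta>)"
  obtain f where f: "f holomorphic_on ball 0 1" "Re (f 0) = ((c + l + d) - (c - d)) / (2 * pi)"
    "\<And>z. cmod z < 1 \<Longrightarrow> \<bar>Re (z * deriv f z)\<bar> \<le> 2 * M"
    "\<And>t x. 0 \<le> t \<Longrightarrow> t < 1 \<Longrightarrow> 0 \<le> Re (f (of_real t * cis x))"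
    "\<And>t x. 0 \<le> t \<Longrightarrow> t < 1 \<Longrightarrow> (c - d) + d \<le> x \<Longrightarrow> x \<le> (c + l + d) - d \<Longrightarrow>
       1 - 2 * pi * C * (1 - t) \<le> Re (f (of_real t * cis x))"
    using smoothed_arc[OF holomorphic_strip_map[OF \<eta>] strip_map_0[OF \<eta>] Re_strip_map_nonneg[OF \<eta>]
        Im_strip_map_bound[OF \<eta>, folded M_def] d(1) _ C, of "c - d" "c + l + d"] d l by auto
  define A where "A = {j \<in> {1..N}. cis (\<theta> j) \<in> (\<lambda>t. cis c * cis t) ` {0..l}}"
  define I where "I s = integral {0..2 * pi} (\<lambda>t. log_plus (\<Prod>j\<in>{1..N}. cmod (cis t - of_real s * cis (\<theta> j))))"
    for s :: real
  have le: "real (card A) * (1 - 2 * pi * C * (1 - s\<^sup>2))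
      \<le> (l + 2 * d) / (2 * pi) * real N + 2 * (2 * M) / pi * I s" if s: "0 < s" "s < 1" for s
  proof -
    have s2: "0 \<le> s\<^sup>2" "s\<^sup>2 < 1" using s by (auto simp: abs_square_less_1)
    have "real (card A) * (1 - 2 * pi * C * (1 - s\<^sup>2)) = (\<Sum>j\<in>A. 1 - 2 * pi * C * (1 - s\<^sup>2))"
      by simp
    also have "\<dots> \<le> (\<Sum>j\<in>A. Re (f (of_real (s\<^sup>2) * cis (\<theta> j))))"
    proof (rule sum_mono)
      fix j assume "j \<in> A"
      then obtain x where "x \<in> {0..l}" "cis (\<theta> j) = cis (c + x)"
        by (auto simp: A_def cis_mult)
      then show "1 - 2 * pi * C * (1 - s\<^sup>2) \<le> Re (f (of_real (s\<^sup>2) * cis (\<theta> j)))"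
        using f(5)[OF s2, of "c + x"] by simp
    qed
    also have "\<dots> \<le> (\<Sum>j\<in>{1..N}. Re (f (of_real (s\<^sup>2) * cis (\<theta> j))))"
      using f(4)[OF s2] by (intro sum_mono2) (auto simp: A_def)
    also have "\<dots> = (l + 2 * d) / (2 * pi) * real N + (\<Sum>j\<in>{1..N}. Re (f (of_real (s\<^sup>2) * cis (\<theta> j)) - f 0))"
      by (simp add: sum_subtractf f(2))
    also have "\<dots> \<le> (l + 2 * d) / (2 * pi) * real N + 2 * (2 * M) / pi * I s"
      unfolding I_def using sum_deviation_le[OF f(1,3) s] by (intro add_left_mono)
    finally show ?thesis .
  qed
  \<comment> \<open>The integrand is jointly continuous, also at \<open>s = 1\<close> where the
    product may vanish, so the limit passes under the integral.\<close>
  have "continuous_on UNIV I"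
  proof -
    have "continuous_on (UNIV \<times> cbox 0 (2 * pi))
        (\<lambda>(s, t). log_plus (\<Prod>j\<in>{1..N}. cmod (cis t - of_real s * cis (\<theta> j))))"
      unfolding case_prod_unfold by (intro continuous_intros)
    from integral_continuous_on_param[OF this] show ?thesis unfolding I_def by simp
  qed
  then have I: "(I \<longlongrightarrow> I 1) (at_left 1)"
    by (simp add: continuous_on_eq_continuous_within continuous_at_imp_continuous_within flip: continuous_within)
  have "((\<lambda>s. real (card A) * (1 - 2 * pi * C * (1 - s\<^sup>2))) \<longlongrightarrow> real (card A) * (1 - 2 * pi * C * (1 - 1\<^sup>2))) (at_left 1)"
    by (intro tendsto_intros)
  moreover have "((\<lambda>s. (l + 2 * d) / (2 * pi) * real N + 2 * (2 * M) / pi * I s) \<longlongrightarrow>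
      (l + 2 * d) / (2 * pi) * real N + 2 * (2 * M) / pi * I 1) (at_left 1)"
    by (intro tendsto_intros I)
  moreover have "\<forall>\<^sub>F s in at_left 1. real (card A) * (1 - 2 * pi * C * (1 - s\<^sup>2))
      \<le> (l + 2 * d) / (2 * pi) * real N + 2 * (2 * M) / pi * I s"
    using eventually_at_left_real[of 0 1] by (rule eventually_mono) (use le in auto)
  ultimately have "real (card A) * (1 - 2 * pi * C * (1 - 1\<^sup>2))
      \<le> (l + 2 * d) / (2 * pi) * real N + 2 * (2 * M) / pi * I 1"
    by (intro tendsto_le[of "at_left (1 :: real)"]) auto
  then have "real (card A) \<le> (l + 2 * d) / (2 * pi) * real N + 2 * (2 * M) / pi * I 1" by simp
  also have "2 * (2 * M) / pi * I 1 = 8 / (pi * d) * (1 / pi * I 1)" by (simp add: M_def \<eta>_def)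
  also have "I 1 = integral {0..2 * pi} (\<lambda>t. log_plus (\<Prod>j\<in>{1..N}. cmod (cis t - cis (\<theta> j))))"
    by (simp add: I_def)
  finally show ?thesis unfolding A_def arc_count_def .
qed

section \<open>Moving the roots to the circle and choosing the smoothing scale\<close>

text \<open>The squared distance from \<open>cis t\<close> to \<open>r * cis x\<close> is
  \<open>(1 - r)\<^sup>2\<close> plus \<open>r\<close> times the squared distance from
  \<open>cis t\<close> to \<open>cis x\<close>. Over all roots the divisors \<open>sqrt r\<close>
  multiply to the square root of the modulus of the constant coefficient.\<close>

lemma cmod_circle_le:
  assumes "r > 0"
  shows "cmod (cis t - cis x) \<le> cmod (cis t - of_real r * cis x) / sqrt r"
proof -
  have sq: "(cmod (cis t - of_real a * cis x))\<^sup>2 = (1 - a)\<^sup>2 + a * (2 - 2 * cos (t - x))" for a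
  proof -
    have "(cmod (cis t - of_real a * cis x))\<^sup>2
        = ((sin t)\<^sup>2 + (cos t)\<^sup>2) + a\<^sup>2 * ((sin x)\<^sup>2 + (cos x)\<^sup>2) - 2 * a * cos (t - x)"
      unfolding cmod_power2 cos_diff
      by (simp add: power2_eq_square algebra_simps
          del: sin_cos_squared_add sin_cos_squared_add2 sin_cos_squared_add3)
    from this[unfolded sin_cos_squared_add] show ?thesis
      by (simp add: power2_eq_square algebra_simps)
  qed
  have "(cmod (cis t - cis x))\<^sup>2 * r \<le> (cmod (cis t - of_real r * cis x))\<^sup>2"
  proof -
    have "(cmod (cis t - cis x))\<^sup>2 = 2 - 2 * cos (t - x)" using sq[of 1] by simp
    then have "(cmod (cis t - cis x))\<^sup>2 * r = r * (2 - 2 * cos (t - x))"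
      by (simp only: mult.commute)
    also have "\<dots> \<le> (cmod (cis t - of_real r * cis x))\<^sup>2" unfolding sq[of r] by simp
    finally show ?thesis .
  qed
  then have "cmod (cis t - cis x) * sqrt r \<le> cmod (cis t - of_real r * cis x)"
    using assms by (intro power2_le_imp_le[OF _ norm_ge_zero])
      (simp only: power_mult_distrib real_sqrt_pow2 less_imp_le)
  then show ?thesis using assms by (subst pos_le_divide_eq) auto
qed

theorem theorem2:
  fixes N :: nat and P :: "complex poly" and \<alpha> :: "nat \<Rightarrow> complex" and \<rho> \<theta> :: "nat \<Rightarrow> real"
  assumes "N \<ge> 1"
    and "P = (\<Prod>j=1..N. [:- \<alpha> j, 1:])"
    and "coeff P 0 \<noteq> 0"
    and "\<And>j. j \<in> {1..N} \<Longrightarrow> \<rho> j > 0 \<and> \<alpha> j = complex_of_real (\<rho> j) * cis (\<theta> j)"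
  shows "discrepancy N \<theta> \<le> 8 / pi * sqrt (real N * log_size P)"
proof -
  define W where "W t = (\<Prod>j\<in>{1..N}. cmod (cis t - cis (\<theta> j)))" for t
  define V where "V t = cmod (poly P (cis t)) / sqrt (cmod (coeff P 0))" for t
  define h where "h = log_size P"
  have coeff0: "cmod (coeff P 0) = (\<Prod>j\<in>{1..N}. \<rho> j)"
    unfolding poly_0_coeff_0[symmetric] assms(2) poly_prod prod_norm[symmetric]
    by (intro prod.cong refl) (use assms(4) in \<open>simp add: norm_mult less_imp_le\<close>)
  have poly: "cmod (poly P (cis t)) = (\<Prod>j\<in>{1..N}. cmod (cis t - of_real (\<rho> j) * cis (\<theta> j)))" for t
    unfolding assms(2) poly_prod prod_norm[symmetric]
    by (intro prod.cong refl) (use assms(4) in simp)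
  have root: "sqrt (\<Prod>j\<in>S. \<rho> j) = (\<Prod>j\<in>S. sqrt (\<rho> j))" for S
    by (induction S rule: infinite_finite_induct) (auto simp: real_sqrt_mult)
  have V: "V t = (\<Prod>j\<in>{1..N}. cmod (cis t - of_real (\<rho> j) * cis (\<theta> j)) / sqrt (\<rho> j))" for t
    unfolding V_def coeff0 poly root prod_dividef ..
  have WV: "W t \<le> V t" for t
    unfolding W_def V using assms(4) by (intro prod_mono conjI cmod_circle_le) auto
  have int_V: "(\<lambda>t. log_plus (V t)) integrable_on {0..2 * pi}"
    unfolding V_def using assms(3) by (intro integrable_continuous_real continuous_intros) auto
  have "integral {0..2 * pi} (\<lambda>t. log_plus (W t)) \<le> integral {0..2 * pi} (\<lambda>t. log_plus (V t))"
  proof (intro integral_le int_V)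
    show "(\<lambda>t. log_plus (W t)) integrable_on {0..2 * pi}"
      unfolding W_def by (intro integrable_continuous_real continuous_intros)
  qed (auto intro: log_plus_mono WV)
  then have int: "1 / pi * integral {0..2 * pi} (\<lambda>t. log_plus (W t)) \<le> 2 * h"
    by (simp add: h_def log_size_def V_def divide_right_mono)
  have h: "0 \<le> h"
    unfolding h_def log_size_def
    by (intro mult_nonneg_nonneg integral_nonneg int_V[unfolded V_def]) (auto simp: log_plus_nonneg)
  \<comment> \<open>A deficit of roots in an arc is an excess in the complementary one, so the upper
    bound for closed arcs suffices.\<close>
  obtain I L where I: "circle_arc I L" and
    disc: "discrepancy N \<theta> = \<bar>real (arc_count N \<theta> I) - L / (2 * pi) * real N\<bar>"
    using discrepancy_attained[of N \<theta>] unfolding arc_deviations_def by blast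
  obtain w l where w: "cmod w = 1" and l: "0 \<le> l" "l \<le> 2 * pi" and
    le: "discrepancy N \<theta> \<le> real (arc_count N \<theta> ((\<lambda>t. w * cis t) ` {0..l})) - l / (2 * pi) * real N"
    using deviation_le_closed_arc[OF I, of N \<theta>] unfolding disc by metis
  have c: "w = cis (Arg w)"
  proof -
    have "cis (Arg w) = sgn w" using w by (intro cis_Arg) auto
    also have "sgn w = w" by (simp only: sgn_eq w) simp
    finally show ?thesis by (rule sym)
  qed
  have key: "discrepancy N \<theta> \<le> d / pi * real N + 16 / (pi * d) * h" if d: "0 < d" "d < pi / 2" for d
  proof -
    have "real (arc_count N \<theta> ((\<lambda>t. w * cis t) ` {0..l}))
      \<le> (l + 2 * d) / (2 * pi) * real N + 8 / (pi * d) * (1 / pi * integral {0..2 * pi} (\<lambda>t. log_plus (W t)))"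
      unfolding W_def by (subst c) (rule arc_count_le[OF d l(1)])
    also have "\<dots> \<le> (l + 2 * d) / (2 * pi) * real N + 8 / (pi * d) * (2 * h)"
      using d by (intro add_left_mono mult_left_mono int) auto
    also have "\<dots> = l / (2 * pi) * real N + (d / pi * real N + 16 / (pi * d) * h)"
      using d by (simp add: field_simps)
    finally show ?thesis using le by linarith
  qed
  have N: "real N > 0" using assms(1) by simp
  \<comment> \<open>The minimiser of the bound in \<open>key\<close>: for \<open>h > 0\<close> both
    terms equal \<open>4 / pi * sqrt (N * h)\<close>.\<close>
  define d where "d = 4 * sqrt (h / N)"
  have root: "sqrt (N * h) = N * sqrt (h / N)"
  proof (rule real_sqrt_unique)
    have "(N * sqrt (h / N))\<^sup>2 = real N * real N * (h / N)"
      using h by (simp add: power_mult_distrib) (simp add: power2_eq_square)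
    then show "(N * sqrt (h / N))\<^sup>2 = N * h" using N by simp
  qed (use h in simp)
  then have opt: "d / pi * real N = 4 / pi * sqrt (N * h)"
    by (simp add: d_def)
  show ?thesis
  proof (cases "d < pi / 2")
    case small: True
    show ?thesis
    proof (cases "h = 0")
      \<comment> \<open>Here \<open>d = 0\<close> is not admissible in \<open>key\<close>, so the
        scale tends to 0 from the right instead.\<close>
      case True
      have lim: "((\<lambda>d. d / pi * real N) \<longlongrightarrow> 0 / pi * real N) (at_right 0)"
        by (intro tendsto_intros) simp
      have "eventually (\<lambda>d. d \<in> {0<..<pi / 2}) (at_right 0)"
        by (rule eventually_at_right_real) simp
      then have ev: "eventually (\<lambda>d. discrepancy N \<theta> \<le> d / pi * real N) (at_right 0)"
      proof (rule eventually_mono)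
        fix d :: real assume "d \<in> {0<..<pi / 2}"
        then show "discrepancy N \<theta> \<le> d / pi * real N" using key[of d] True by simp
      qed
      have "discrepancy N \<theta> \<le> 0 / pi * real N"
        by (rule tendsto_lowerbound[OF lim ev]) simp
      then show ?thesis using True by (simp add: h_def)
    next
      case False
      then have "d > 0" using h N by (simp add: d_def)
      have "16 / (pi * d) * h = 4 / pi * sqrt (N * h)"
      proof -
        have "d * sqrt (N * h) = 4 * real N * (sqrt (h / N))\<^sup>2"
          unfolding root d_def by (simp only: power2_eq_square of_nat_mult of_nat_numeral mult_ac)
        also have "\<dots> = 4 * h" using h N by simp
        finally have "4 * h = d * sqrt (N * h)" ..
        have "16 / (pi * d) * h = 4 / (pi * d) * (4 * h)" by simp
        also note \<open>4 * h = d * sqrt (N * h)\<close>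
        also have "4 / (pi * d) * (d * sqrt (N * h)) = 4 / pi * sqrt (N * h)"
          using \<open>d > 0\<close> by simp
        finally show ?thesis .
      qed
      with key[OF \<open>d > 0\<close> small] opt show ?thesis by (simp add: h_def)
    qed
  next
    \<comment> \<open>For \<open>d \<ge> pi / 2\<close> the trivial bound \<open>N\<close> is
      already at most \<open>2 * d / pi * N\<close>, which is the claimed value.\<close>
    case False
    have "arc_count N \<theta> ((\<lambda>t. w * cis t) ` {0..l}) \<le> card {1..N}"
      unfolding arc_count_def by (intro card_mono) auto
    then have "real (arc_count N \<theta> ((\<lambda>t. w * cis t) ` {0..l})) \<le> real N" by simp
    moreover have "0 \<le> l / (2 * pi) * real N" using l by simp
    ultimately have "discrepancy N \<theta> \<le> real N" using le by linarith
    also have "\<dots> = 2 * ((pi / 2) / pi * real N)" by simp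
    also have "\<dots> \<le> 2 * (d / pi * real N)"
      using False by (intro mult_left_mono mult_right_mono divide_right_mono) auto
    also have "\<dots> = 8 / pi * sqrt (real N * log_size P)" unfolding opt by (simp add: h_def)
    finally show ?thesis .
  qed
qed

end
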